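(* Let $\Phi(u)=\frac12\|\Gamma^{-1/2}(G(u)-y)\|^2$ and $\Phi_N(u)=\frac12\|\Gamma^{-1/2}(G_N(u)-y)\|^2$ be the quadratic misfits of a deterministic forward model $G$ and of random forward models $G_N$, $N\in\mathbb{N}$. (a) Suppose there exists some $p^\ast>1$ such that $\exp(\Phi)\in L^{p^\ast}_{\mu_0}(\mathcal{U})$, and suppose that there exists some $C_4>0$ that does not depend on $N$ such that $\nu_N\left(\{\mathbb{E}_{\mu_0}[\Phi_N]\le C_4\}\right)=1$ for all $N\in\mathbb{N}$. If $$\lim_{N\to\infty}\left\| \mathbb{E}_{\nu_N}\left[\|G-G_N\|^{2q}\right]^{1/q}\right\|_{L^s_{\mu_0}(\mathcal{U})}=0 \quad\text{with } q=2,\ s=\frac{2p^\ast}{p^\ast-1},$$ then: (i) there exists some $C>0$ that does not depend on $N$ such that $$ d_{\mathrm{H}}(\mu,\mu_N^{\mathrm{M}}) \le C \left\| \mathbb{E}_{\nu_N}\left[\|G_N-G\|^{2r_1}\right]^{1/r_1}\right\|_{L^{r_2}_{\mu_0}(\mathcal{U})}^{1/2} \quad\text{with } r_1=1,\ r_2=\frac{2p^\ast}{p^\ast-1};$$ (ii) there exists some $D>0$ that does not depend on $N$ such that $$ \mathbb{E}_{\nu_N}\left[ d_{\mathrm{H}}(\mu,\mu_N^{\mathrm{S}})^2\right]^{1/2} \le D \left\| \mathbb{E}_{\nu_N}\left[\|G_N-G\|^{2s_1}\right]^{1/s_1}\right\|_{L^{s_2}_{\mu_0}(\mathcal{U})}^{1/2}\quad\text{with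 } s_1=2,\ s_2=2.$$ (b) Suppose there exists some $2<\rho^\ast<\infty$ such that $\mathbb{E}_{\nu_N}[\exp(\rho^\ast\Phi_N)]\in L^1_{\mu_0}(\mathcal{U})$ for all $N$. If $$\lim_{N\to\infty}\left\| \mathbb{E}_{\nu_N}\left[\|G-G_N\|^{2q}\right]^{1/q}\right\|_{L^s_{\mu_0}(\mathcal{U})}=0 \quad\text{with } q=\frac{2\rho^\ast}{\rho^\ast-2},\ s=\frac{2\rho^\ast}{\rho^\ast-1},$$ then: (i) there exists some $C>0$ that does not depend on $N$ such that $$ d_{\mathrm{H}}(\mu,\mu_N^{\mathrm{M}}) \le C \left\| \mathbb{E}_{\nu_N}\left[\|G_N-G\|^{2r_1}\right]^{1/r_1}\right\|_{L^{r_2}_{\mu_0}(\mathcal{U})}^{1/2} \quad\text{with } r_1=1,\ r_2=\frac{2\rho^\ast}{\rho^\ast-1};$$ (ii) there exists some $D>0$ that does not depend on $N$ such that $$ \mathbb{E}_{\nu_N}\left[ d_{\mathrm{H}}(\mu,\mu_N^{\mathrm{S}})^2\right]^{1/2} \le D \left\| \mathbb{E}_{\nu_N}\left[\|G_N-G\|^{2s_1}\right]^{1/s_1}\right\|_{L^{s_2}_{\mu_0}(\mathcal{U})}^{1/2}\quad\text{with } s_1=\frac{2\rho^\ast}{\rho^\ast-2},\ s_2=2.$$ In both cases (a) and (b), $d_{\mathrm{H}}(\mu,\mu_N^{\mathrm{M}})\to 0$ and $\mathbb{E}_{\nu_N}[d_{\mathrm{H}}(\mu,\mu_N^{\mathrm{S}})^2]^{1/2}\to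 0$ as $N\to\infty$.
   Context: $\mathcal{U}$ is a separable Banach space with its Borel $\sigma$-algebra and $\mu_0$ is a probability measure (prior) on it. The data space is $\mathcal{Y}=\mathbb{R}^J$, $J\in\mathbb{N}$, with Euclidean norm $\|\cdot\|$; $y\in\mathcal{Y}$ is fixed and $\Gamma$ is a symmetric positive-definite $J\times J$ matrix. $G:\mathcal{U}\to\mathcal{Y}$ is measurable and deterministic. For each $N\in\mathbb{N}$, $G_N:\Omega\times\mathcal{U}\to\mathcal{Y}$ is measurable and $\nu_N$ is a probability measure on $\Omega$; the arguments $(\omega,u)$ are distributed as $\nu_N\otimes\mu_0$ (the randomness of $G_N$ is independent of $u$), and the argument $\omega$ is suppressed. $\mathbb{E}_{\nu_N}$ is integration over $\omega$ only, so $\mathbb{E}_{\nu_N}[\|G-G_N\|^{2q}]^{1/q}$ is a function of $u$. The normalising constants are $Z:=\mathbb{E}_{\mu_0}[\exp(-\Phi)]$, with $0<Z<\infty$, and $Z_N^{\mathrm{S}}(\omega):=\mathbb{E}_{\mu_0}[\exp(-\Phi_N(\omega,\cdot))]$. The exact posterior $\mu$, sample approximate posterior $\mu_N^{\mathrm{S}}$ (a random measure) and marginal approximate posterior $\mu_N^{\mathrm{M}}$ are given by $$\frac{d\mu}{d\mu_0}(u)=\frac{e^{-\Phi(u)}}{Z},\qquad \frac{d\mu_N^{\mathrm{S}}}{d\mu_0}(\omega,u)=\frac{e^{-\Phi_N(\omega,u)}}{Z_N^{\mathrm{S}}(\omega)},\qquad \frac{d\mu_N^{\mathrm{M}}}{d\mu_0}(u)=\frac{\mathbb{E}_{\nu_N}[e^{-\Phi_N(u)}]}{\mathbb{E}_{\nu_N}[Z_N^{\mathrm{S}}]}.$$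 The Hellinger distance of probability measures $\mu,\nu$ absolutely continuous with respect to a reference measure $\pi$ is $d_{\mathrm{H}}(\mu,\nu)^2 := \frac12\int_{\mathcal{U}} \left| \sqrt{d\mu/d\pi}-\sqrt{d\nu/d\pi}\right|^2 d\pi$. *)

theory Defs
  imports "HOL-Probability.Probability"
begin

definition sym_pos_def :: "real^'n^'n \<Rightarrow> bool" where
  "sym_pos_def A \<longleftrightarrow> transpose A = A \<and> (\<forall>x. x \<noteq> 0 \<longrightarrow> 0 < x \<bullet> (A *v x))"

text \<open>For symmetric positive definite A, the inverse of A is again symmetric positive definite, so
  it has exactly one symmetric positive definite square root.\<close>

definition inv_sqrt :: "real^'n^'n \<Rightarrow> real^'n^'n" where
  "inv_sqrt A = (THE S. sym_pos_def S \<and> S ** S = matrix_inv A)"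

definition misfit :: "real^'n^'n \<Rightarrow> real^'n \<Rightarrow> real^'n \<Rightarrow> real" where
  "misfit \<Gamma> y v = 1/2 * (norm (inv_sqrt \<Gamma> *v (v - y)))\<^sup>2"

text \<open>Real powers of extended nonnegative reals; only exponents a > 0 are used, for which the
  value at infinity is infinity. Norms and expectations of nonnegative functions are taken in
  ennreal throughout, so that a divergent integral has the value infinity instead of 0.\<close>

definition epowr :: "ennreal \<Rightarrow> real \<Rightarrow> ennreal" where
  "epowr x a = (if x = \<infinity> then \<infinity> else ennreal (enn2real x powr a))"

definition Lp_norm :: "'a measure \<Rightarrow> real \<Rightarrow> ('a \<Rightarrow> ennreal) \<Rightarrow> ennreal" where
  "Lp_norm M p f = epowr (\<integral>\<^sup>+ x. epowr (f x) p \<partial>M) (1 / p)"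

definition in_Lp :: "'a measure \<Rightarrow> real \<Rightarrow> ('a \<Rightarrow> ennreal) \<Rightarrow> bool" where
  "in_Lp M p f \<longleftrightarrow> f \<in> borel_measurable M \<and> Lp_norm M p f < \<infinity>"

text \<open>The function u \<open>\<mapsto>\<close> E[|G(u) - H(\<open>\<cdot>\<close>, u)|^(2q)]^(1/q), where H is a random forward model and
  the expectation is over the randomness of H only.\<close>

definition mean_err ::
    "'w measure \<Rightarrow> ('u \<Rightarrow> 'v::real_normed_vector) \<Rightarrow> ('w \<Rightarrow> 'u \<Rightarrow> 'v) \<Rightarrow> real \<Rightarrow> 'u \<Rightarrow> ennreal" where
  "mean_err \<nu> G H q u = epowr (\<integral>\<^sup>+ \<omega>. ennreal (norm (G u - H \<omega> u) powr (2 * q)) \<partial>\<nu>) (1 / q)"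

definition norm_const :: "'u measure \<Rightarrow> ('u \<Rightarrow> real) \<Rightarrow> ennreal" where
  "norm_const \<mu>0 \<Phi> = (\<integral>\<^sup>+ u. ennreal (exp (- \<Phi> u)) \<partial>\<mu>0)"

text \<open>The sample approximate posterior for the outcome \<open>\<omega>\<close> is the posterior of the potential
  \<open>\<Psi> \<omega>\<close>.\<close>

definition posterior :: "'u measure \<Rightarrow> ('u \<Rightarrow> real) \<Rightarrow> 'u measure" where
  "posterior \<mu>0 \<Phi> = density \<mu>0 (\<lambda>u. ennreal (exp (- \<Phi> u)) / norm_const \<mu>0 \<Phi>)"

definition marginal_posterior ::
    "'w measure \<Rightarrow> 'u measure \<Rightarrow> ('w \<Rightarrow> 'u \<Rightarrow> real) \<Rightarrow> 'u measure" where
  "marginal_posterior \<nu> \<mu>0 \<Psi> =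
     density \<mu>0 (\<lambda>u. (\<integral>\<^sup>+ \<omega>. ennreal (exp (- \<Psi> \<omega> u)) \<partial>\<nu>) / (\<integral>\<^sup>+ \<omega>. norm_const \<mu>0 (\<Psi> \<omega>) \<partial>\<nu>))"

text \<open>Meant for probability measures that are absolutely continuous with respect to the reference
  measure \<open>\<pi>\<close>, whose Radon-Nikodym derivatives are almost everywhere finite.\<close>

definition hellinger :: "'u measure \<Rightarrow> 'u measure \<Rightarrow> 'u measure \<Rightarrow> ennreal" where
  "hellinger \<pi> \<mu> \<nu> =
     epowr (1/2 * (\<integral>\<^sup>+ u. ennreal (\<bar>sqrt (enn2real (RN_deriv \<pi> \<mu> u)) - sqrt (enn2real (RN_deriv \<pi> \<nu> u))\<bar>\<^sup>2) \<partial>\<pi>)) (1/2)"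

end

theory Submission
  imports Defs
begin

text \<open>
  The proof works with the square roots \<open>exp (- \<Phi> / 2)\<close> of the likelihoods. Two facts carry it.

  First, the square root of the likelihood is a globally Lipschitz function of the model output:
  it is \<open>exp (- s\<^sup>2 / 4)\<close> at \<open>s = |\<Gamma>\<^bsup>-1/2\<^esup> (v - y)|\<close>, Lipschitz in \<open>s\<close>, and \<open>s\<close> is Lipschitz in \<open>v\<close>
  (lemma \<open>root_likelihood_lipschitz\<close>). So the \<open>L\<^sup>2\<close> distance of two such square roots is at most a
  constant times the root mean square error of the model.

  Second, normalising costs only the normalising constant of the exact posterior. The Hellinger
  distance is, up to the factor \<open>1/2\<close> in the square, the distance of the unit vectors \<open>f / |f|\<close> and
  \<open>g / |g|\<close> of \<open>L\<^sup>2\<close>, where \<open>f\<close> and \<open>g\<close> are the roots of the unnormalised densities, and moving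
  two nonnegative functions to the unit sphere satisfies
  \<open>1/2 |f / |f| - g / |g||\<^sup>2 \<le> |f - g|\<^sup>2 / |f|\<^sup>2\<close> (lemma \<open>hellinger_power2_le\<close>). There is no lower
  bound on \<open>|g|\<close> in this estimate, so the approximate normalising constants may be arbitrarily
  small.

  For the sample posterior this applies for each \<open>\<omega>\<close>, followed by integration over \<open>\<omega>\<close>. For the
  marginal posterior, \<open>g u\<close> is the \<open>L\<^sup>2(\<nu>)\<close> norm of \<open>exp (- \<Phi>\<^sub>N (\<cdot>, u) / 2)\<close>, and the reverse
  triangle inequality in \<open>L\<^sup>2(\<nu>)\<close> bounds \<open>|f u - g u|\<close> (lemma \<open>power2_diff_L2_norm_le\<close>).

  In both cases the squared distance is at most a constant times the double integral of
  \<open>|G - G\<^sub>N|\<^sup>2\<close>, that is, the \<open>L\<^sup>1\<close> norm of the mean error of order 1. On probability spaces \<open>L\<^sup>p\<close>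
  norms increase with \<open>p\<close>, so this is at most each of the norms in the theorem, which gives the
  rates and, since the norms tend to 0, the convergence.
\<close>

section \<open>Real powers and Lebesgue norms of extended nonnegative functions\<close>

lemma epowr_ennreal: "0 \<le> x \<Longrightarrow> epowr (ennreal x) a = ennreal (x powr a)"
  by (simp add: epowr_def)

lemma epowr_one [simp]: "epowr x 1 = x"
  by (cases x) (auto simp: epowr_def)

lemma epowr_mono: "x \<le> y \<Longrightarrow> 0 \<le> a \<Longrightarrow> epowr x a \<le> epowr y a"
  by (cases x; cases y) (auto simp: epowr_def intro!: ennreal_leI powr_mono2 simp: top_unique)

lemma epowr_epowr_inverse: "0 < a \<Longrightarrow> epowr (epowr x a) (1 / a) = x"
  by (cases x) (auto simp: epowr_def powr_powr)

lemma epowr_half_power2: "(epowr x (1/2))\<^sup>2 = x"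
  by (cases x) (auto simp: epowr_def powr_half_sqrt ennreal_power)

lemma epowr_power2_half: "epowr (x\<^sup>2) (1/2) = x"
  by (cases x) (auto simp: epowr_def powr_half_sqrt ennreal_power)

lemma epowr_cmult: "0 < c \<Longrightarrow> epowr (ennreal c * x) a = ennreal (c powr a) * epowr x a"
  by (cases x) (auto simp: epowr_def powr_mult ennreal_mult_top simp flip: ennreal_mult)

lemma borel_measurable_epowr [measurable (raw)]:
  assumes [measurable]: "f \<in> borel_measurable M"
  shows "(\<lambda>x. epowr (f x) a) \<in> borel_measurable M"
  unfolding epowr_def by measurable

lemma tendsto_epowr_zero:
  assumes "(f \<longlongrightarrow> 0) F" and a: "0 < a"
  shows "((\<lambda>x. epowr (f x) a) \<longlongrightarrow> 0) F"
proof (rule tendsto_sandwich[where f = "\<lambda>_. 0"])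
  show "\<forall>\<^sub>F x in F. epowr (f x) a \<le> ennreal (enn2real (f x) powr a)"
    using order_tendstoD(2)[OF assms(1), of \<top>] by (auto simp: epowr_def elim: eventually_mono)
  have "((\<lambda>x. enn2real (f x)) \<longlongrightarrow> 0) F"
    using tendsto_enn2real[of f 0 F] assms(1) by simp
  then have "((\<lambda>x. enn2real (f x) powr a) \<longlongrightarrow> 0) F"
    using a by (intro tendsto_zero_powrI[where b = a]) auto
  then show "((\<lambda>x. ennreal (enn2real (f x) powr a)) \<longlongrightarrow> 0) F"
    using tendsto_ennrealI ennreal_0 by metis
qed auto

lemma Lp_norm_mono:
  assumes "\<And>x. x \<in> space M \<Longrightarrow> f x \<le> g x" and "0 < p"
  shows "Lp_norm M p f \<le> Lp_norm M p g"
  using assms unfolding Lp_norm_def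
  by (intro epowr_mono nn_integral_mono) auto

text \<open>The case of Jensen's inequality that is needed here, by the usual proof of Hoelder's
  inequality: with \<open>t\<close> the \<open>L\<^sup>p\<close> norm of \<open>f\<close>, integrate \<open>t\<close> times Young's inequality for the
  product of \<open>f / t\<close> and 1.\<close>
lemma (in prob_space) nn_integral_le_Lp_norm:
  assumes [measurable]: "f \<in> borel_measurable M" and p: "1 \<le> p"
  shows "(\<integral>\<^sup>+ x. f x \<partial>M) \<le> Lp_norm M p f"
proof (cases "p = 1")
  case True
  then show ?thesis by (simp add: Lp_norm_def)
next
  case False
  with p have p: "1 < p" by simp
  show ?thesis
  proof (cases "Lp_norm M p f")
    case (real t)
    have I: "(\<integral>\<^sup>+ x. epowr (f x) p \<partial>M) = ennreal (t powr p)"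
      using epowr_epowr_inverse[of "1/p" "\<integral>\<^sup>+ x. epowr (f x) p \<partial>M"] p real
      by (simp add: Lp_norm_def epowr_ennreal)
    show ?thesis
    proof (cases "t = 0")
      case True
      then have "AE x in M. epowr (f x) p = 0"
        using I by (simp add: nn_integral_0_iff_AE)
      then have "AE x in M. f x = 0"
        by eventually_elim (auto simp: epowr_def enn2real_eq_0_iff split: if_splits)
      then have "(\<integral>\<^sup>+ x. f x \<partial>M) = 0" by (simp add: nn_integral_0_iff_AE)
      then show ?thesis by simp
    next
      case False
      with real have t: "0 < t" by simp
      define q where "q = p / (p - 1)"
      have q: "1 < q" "1 / p + 1 / q = 1" using p by (auto simp: q_def field_simps)
      have young: "f x \<le> ennreal (t / (p * t powr p)) * epowr (f x) p + ennreal (t / q)" for x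
      proof (cases "f x")
        case (real r)
        have "(r / t) * 1 \<le> (r / t) powr p / p + 1 powr q / q"
          using Youngs_inequality[of p q "r / t" 1] p q real t by auto
        then have "t * (r / t) \<le> t * ((r / t) powr p / p + 1 / q)"
          using t by (intro mult_left_mono) auto
        then have "r \<le> t / (p * t powr p) * r powr p + t / q"
          using t real by (simp add: powr_divide field_simps)
        then show ?thesis
          using real t p q by (simp add: epowr_ennreal flip: ennreal_mult ennreal_plus)
      next
        case top
        then show ?thesis using t p by (simp add: epowr_def ennreal_mult_top)
      qed
      have "(\<integral>\<^sup>+ x. f x \<partial>M) \<le> (\<integral>\<^sup>+ x. ennreal (t / (p * t powr p)) * epowr (f x) p + ennreal (t / q) \<partial>M)"
        by (intro nn_integral_mono young)
      also have "\<dots> = ennreal (t / (p * t powr p)) * ennreal (t powr p) + ennreal (t / q)"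
        by (simp add: nn_integral_add nn_integral_cmult I emeasure_space_1)
      also have "\<dots> = ennreal (t * (1 / p + 1 / q))"
        using t p q(1) by (simp add: field_simps flip: ennreal_mult ennreal_plus)
      finally show ?thesis using real q by simp
    qed
  qed simp
qed

section \<open>The square root of the likelihood is Lipschitz\<close>

text \<open>The derivative \<open>- s / 2 * exp (- s\<^sup>2 / 4)\<close> is bounded by 1.\<close>
lemma abs_diff_exp_neg_square_le:
  fixes s t :: real
  shows "\<bar>exp (- s\<^sup>2 / 4) - exp (- t\<^sup>2 / 4)\<bar> \<le> \<bar>s - t\<bar>"
proof -
  have D: "\<bar>exp (- x\<^sup>2 / 4) * (- x / 2)\<bar> \<le> 1" for x :: real
  proof -
    have "\<bar>x\<bar> / 2 \<le> 1 + x\<^sup>2 / 4"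
      using zero_le_power2[of "\<bar>x\<bar> - 1"] by (simp add: power2_eq_square algebra_simps)
    also have "\<dots> \<le> exp (x\<^sup>2 / 4)" by (rule exp_ge_add_one_self)
    finally show ?thesis by (simp add: abs_mult exp_minus field_simps)
  qed
  have "norm (exp (- s\<^sup>2 / 4) - exp (- t\<^sup>2 / 4)) \<le> 1 * norm (s - t)"
    by (rule field_differentiable_bound[of UNIV _ "\<lambda>x. exp (- x\<^sup>2 / 4) * (- x / 2)"])
       (use D in \<open>auto intro!: derivative_eq_intros\<close>)
  then show ?thesis by simp
qed

text \<open>Compose the previous bound with \<open>v \<mapsto> norm (inv_sqrt \<Gamma> *v (v - y))\<close>, which is Lipschitz
  because a matrix is a bounded operator.\<close>
lemma root_likelihood_lipschitz:
  fixes \<Gamma> :: "real^'n^'n"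
  obtains L where "0 < L"
    "\<And>v w. \<bar>exp (- misfit \<Gamma> y v / 2) - exp (- misfit \<Gamma> y w / 2)\<bar> \<le> L * norm (v - w)"
proof -
  define A where "A = inv_sqrt \<Gamma>"
  obtain L where L: "0 < L" "\<And>x. norm (A *v x) \<le> L * norm x"
    using linear_bounded_pos[OF matrix_vector_mul_linear[of A]] by (metis mult.commute)
  have "\<bar>exp (- misfit \<Gamma> y v / 2) - exp (- misfit \<Gamma> y w / 2)\<bar> \<le> L * norm (v - w)" for v w
  proof -
    have "\<bar>exp (- misfit \<Gamma> y v / 2) - exp (- misfit \<Gamma> y w / 2)\<bar>
        \<le> \<bar>norm (A *v (v - y)) - norm (A *v (w - y))\<bar>"
      using abs_diff_exp_neg_square_le[of "norm (A *v (v - y))" "norm (A *v (w - y))"]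
      by (simp add: misfit_def A_def)
    also have "\<dots> \<le> norm (A *v (v - y) - A *v (w - y))" by (rule norm_triangle_ineq3)
    also have "\<dots> = norm (A *v (v - w))" by (simp flip: matrix_vector_mult_diff_distrib)
    also have "\<dots> \<le> L * norm (v - w)" by (rule L)
    finally show ?thesis .
  qed
  with L(1) show ?thesis by (rule that)
qed

lemma continuous_misfit: "continuous_on UNIV (misfit \<Gamma> y)"
  unfolding misfit_def
  by (intro continuous_intros linear_continuous_on_compose[OF _ matrix_vector_mul_linear])

lemma misfit_nonneg: "0 \<le> misfit \<Gamma> y v"
  by (simp add: misfit_def)

lemma borel_measurable_misfit [measurable]: "misfit \<Gamma> y \<in> borel_measurable borel"
  by (rule borel_measurable_continuous_onI[OF continuous_misfit])

section \<open>Hellinger distance from unnormalised root densities\<close>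

text \<open>Let \<open>a\<close> and \<open>b\<close> be the \<open>L\<^sup>2\<close> norms of \<open>f\<close> and \<open>g\<close>, and let \<open>\<theta>\<close> in \<open>[0, 1]\<close> be the cosine of
  the angle between them. The squared Hellinger distance is \<open>1 - \<theta>\<close>, whereas
  \<open>|f - g|\<^sup>2 / a\<^sup>2 = (1 - \<theta>\<^sup>2) + (b / a - \<theta>)\<^sup>2\<close> is at least \<open>(1 - \<theta>) (1 + \<theta>)\<close>: whatever the length
  \<open>b\<close> of \<open>g\<close>, the distance of \<open>f\<close> from the line through \<open>g\<close> already controls the angle.
  It is because \<open>f\<close> and \<open>g\<close> are nonnegative that \<open>\<theta> \<ge> 0\<close>.\<close>
lemma (in sigma_finite_measure) hellinger_power2_le:
  fixes f g :: "'a \<Rightarrow> real"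
  assumes [measurable]: "f \<in> borel_measurable M" "g \<in> borel_measurable M"
    and nonneg: "\<And>x. 0 \<le> f x" "\<And>x. 0 \<le> g x"
    and \<alpha>: "(\<integral>\<^sup>+ x. ennreal ((f x)\<^sup>2) \<partial>M) = ennreal \<alpha>" "0 < \<alpha>"
    and \<beta>: "(\<integral>\<^sup>+ x. ennreal ((g x)\<^sup>2) \<partial>M) = ennreal \<beta>" "0 < \<beta>"
  shows "(hellinger M (density M (\<lambda>x. ennreal ((f x)\<^sup>2) / ennreal \<alpha>))
             (density M (\<lambda>x. ennreal ((g x)\<^sup>2) / ennreal \<beta>)))\<^sup>2
    \<le> (\<integral>\<^sup>+ x. ennreal ((f x - g x)\<^sup>2) \<partial>M) / ennreal \<alpha>" (is "?H \<le> _")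
proof -
  define a where "a = sqrt \<alpha>"
  define b where "b = sqrt \<beta>"
  have a: "0 < a" "a\<^sup>2 = \<alpha>" and b: "0 < b" "b\<^sup>2 = \<beta>"
    using \<alpha> \<beta> by (auto simp: a_def b_def)
  define c where "c = (\<integral>x. f x * g x \<partial>M)"
  have f2: "integrable M (\<lambda>x. (f x)\<^sup>2)" "(\<integral>x. (f x)\<^sup>2 \<partial>M) = \<alpha>"
    using nn_integral_eq_integrable[of "\<lambda>x. (f x)\<^sup>2" M \<alpha>] \<alpha> by auto
  have g2: "integrable M (\<lambda>x. (g x)\<^sup>2)" "(\<integral>x. (g x)\<^sup>2 \<partial>M) = \<beta>"
    using nn_integral_eq_integrable[of "\<lambda>x. (g x)\<^sup>2" M \<beta>] \<beta> by auto
  have fg: "integrable M (\<lambda>x. f x * g x)"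
  proof (rule Bochner_Integration.integrable_bound)
    show "integrable M (\<lambda>x. (f x)\<^sup>2 + (g x)\<^sup>2)" using f2 g2 by simp
    have "f x * g x \<le> (f x)\<^sup>2 + (g x)\<^sup>2" for x
      using sum_squares_bound[of "f x" "g x"] nonneg[of x] mult_nonneg_nonneg[of "f x" "g x"] by linarith
    then show "AE x in M. norm (f x * g x) \<le> norm ((f x)\<^sup>2 + (g x)\<^sup>2)"
      using nonneg by (auto simp: abs_mult)
  qed simp
  have expand: "(s * f x - t * g x)\<^sup>2 = s\<^sup>2 * (f x)\<^sup>2 + t\<^sup>2 * (g x)\<^sup>2 - 2 * s * t * (f x * g x)"
    for s t :: real and x
    by (simp add: power2_eq_square algebra_simps)
  have quad_integral: "(\<integral>x. (s * f x - t * g x)\<^sup>2 \<partial>M) = s\<^sup>2 * \<alpha> + t\<^sup>2 * \<beta> - 2 * s * t * c" for s t :: real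
    using f2 g2 fg by (simp add: expand c_def)
  have quad_nonneg: "0 \<le> s\<^sup>2 * \<alpha> + t\<^sup>2 * \<beta> - 2 * s * t * c" for s t :: real
    unfolding quad_integral[symmetric] by simp
  have quad: "(\<integral>\<^sup>+ x. ennreal ((s * f x - t * g x)\<^sup>2) \<partial>M) = ennreal (s\<^sup>2 * \<alpha> + t\<^sup>2 * \<beta> - 2 * s * t * c)"
    for s t :: real
  proof -
    have "integrable M (\<lambda>x. (s * f x - t * g x)\<^sup>2)"
      using f2 g2 fg by (simp add: expand)
    then show ?thesis by (simp add: nn_integral_eq_integral quad_integral)
  qed
  have RN: "AE x in M. ennreal ((h x)\<^sup>2) / ennreal \<gamma> = RN_deriv M (density M (\<lambda>x. ennreal ((h x)\<^sup>2) / ennreal \<gamma>)) x"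
    if [measurable]: "h \<in> borel_measurable M" for h :: "'a \<Rightarrow> real" and \<gamma>
    by (rule RN_deriv_unique[OF _ refl]) measurable
  have "?H = 1/2 * (\<integral>\<^sup>+ x. ennreal ((1 / a * f x - 1 / b * g x)\<^sup>2) \<partial>M)"
    unfolding hellinger_def epowr_half_power2
  proof (intro arg_cong2[where f = "(*)"] refl nn_integral_cong_AE)
    show "AE x in M. ennreal (\<bar>sqrt (enn2real (RN_deriv M (density M (\<lambda>x. ennreal ((f x)\<^sup>2) / ennreal \<alpha>)) x))
            - sqrt (enn2real (RN_deriv M (density M (\<lambda>x. ennreal ((g x)\<^sup>2) / ennreal \<beta>)) x))\<bar>\<^sup>2)
          = ennreal ((1 / a * f x - 1 / b * g x)\<^sup>2)"
      using RN[of f \<alpha>, OF assms(1)] RN[of g \<beta>, OF assms(2)]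
    proof eventually_elim
      case (elim x)
      then show ?case
        unfolding elim[symmetric] using \<alpha>(2) \<beta>(2) nonneg[of x]
        by (simp add: divide_ennreal real_sqrt_divide a_def b_def)
    qed
  qed
  also have "\<dots> = ennreal (1 - c / (a * b))"
  proof -
    have "(1 / a)\<^sup>2 * \<alpha> + (1 / b)\<^sup>2 * \<beta> - 2 * (1 / a) * (1 / b) * c = 2 * (1 - c / (a * b))"
      using a b \<alpha>(2) \<beta>(2) by (simp add: power_divide field_simps)
    moreover have "1/2 * ennreal (2 * t) = ennreal t" for t
      using ennreal_mult'[of "1/2" "2 * t"] by (simp add: divide_ennreal_def)
    ultimately show ?thesis
      unfolding quad by metis
  qed
  also have "\<dots> \<le> ennreal ((\<alpha> + \<beta> - 2 * c) / \<alpha>)"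
  proof (rule ennreal_leI)
    define \<theta> where "\<theta> = c / (a * b)"
    have c: "c = \<theta> * a * b" using a b by (simp add: \<theta>_def)
    have "0 \<le> c" unfolding c_def using nonneg by (intro Bochner_Integration.integral_nonneg) auto
    then have "0 \<le> \<theta>" using a b by (simp add: \<theta>_def)
    \<comment> \<open>the Cauchy-Schwarz inequality, from the squared distance of the two unit vectors\<close>
    moreover have "\<theta> \<le> 1"
    proof -
      have "0 \<le> 2 * (1 - \<theta>)"
        using quad_nonneg[of "1 / a" "1 / b"] a b \<alpha>(2) \<beta>(2) by (simp add: power_divide \<theta>_def)
      then show ?thesis by simp
    qed
    ultimately have "0 \<le> a\<^sup>2 * (\<theta> * (1 - \<theta>)) + (b - \<theta> * a)\<^sup>2" by simp
    also have "\<dots> = (\<alpha> + \<beta> - 2 * c) - (1 - \<theta>) * \<alpha>"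
      unfolding c a(2)[symmetric] b(2)[symmetric] by (simp add: power2_eq_square algebra_simps)
    finally show "1 - c / (a * b) \<le> (\<alpha> + \<beta> - 2 * c) / \<alpha>"
      using \<alpha>(2) by (simp add: \<theta>_def[symmetric] field_simps)
  qed
  also have "\<dots> = (\<integral>\<^sup>+ x. ennreal ((f x - g x)\<^sup>2) \<partial>M) / ennreal \<alpha>"
    using quad[of 1 1] quad_nonneg[of 1 1] \<alpha>(2) by (simp add: divide_ennreal)
  finally show ?thesis .
qed

lemma (in prob_space) norm_const_pos_finite:
  assumes [measurable]: "\<Phi> \<in> borel_measurable M" and "\<And>u. 0 \<le> \<Phi> u"
  obtains z where "norm_const M \<Phi> = ennreal z" "0 < z"
proof -
  have "norm_const M \<Phi> \<le> (\<integral>\<^sup>+ u. 1 \<partial>M)"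
    unfolding norm_const_def using assms by (intro nn_integral_mono) auto
  then have "norm_const M \<Phi> \<noteq> \<infinity>" by (auto simp: emeasure_space_1 top_unique)
  moreover have "norm_const M \<Phi> \<noteq> 0"
    unfolding norm_const_def using AE_False by (simp add: nn_integral_0_iff_AE)
  ultimately show ?thesis
    using that by (cases "norm_const M \<Phi>") (auto simp: less_le)
qed

lemma (in prob_space) hellinger_posterior_le:
  assumes [measurable]: "\<Phi> \<in> borel_measurable M" "\<Psi> \<in> borel_measurable M"
    and "\<And>u. 0 \<le> \<Phi> u" "\<And>u. 0 \<le> \<Psi> u"
  shows "(hellinger M (posterior M \<Phi>) (posterior M \<Psi>))\<^sup>2
    \<le> (\<integral>\<^sup>+ u. ennreal ((exp (- \<Phi> u / 2) - exp (- \<Psi> u / 2))\<^sup>2) \<partial>M) / norm_const M \<Phi>"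
proof -
  have sq: "(exp (- (t / 2)))\<^sup>2 = exp (- t)" for t :: real
    by (simp add: power2_eq_square flip: exp_add)
  obtain z where z: "norm_const M \<Phi> = ennreal z" "0 < z"
    using assms by (elim norm_const_pos_finite)
  obtain w where w: "norm_const M \<Psi> = ennreal w" "0 < w"
    using assms by (elim norm_const_pos_finite)
  show ?thesis
    using hellinger_power2_le[of "\<lambda>u. exp (- \<Phi> u / 2)" "\<lambda>u. exp (- \<Psi> u / 2)" z w] z w
    by (simp add: sq posterior_def norm_const_def)
qed

text \<open>The reverse triangle inequality in \<open>L\<^sup>2\<close> between the constant \<open>r\<close>, which has norm \<open>r\<close> on a
  probability space, and \<open>X\<close>. After expanding the squares it says that the mean of \<open>X\<close> is at most
  its \<open>L\<^sup>2\<close> norm, which is the nonnegativity of the variance.\<close>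
lemma (in prob_space) power2_diff_L2_norm_le:
  fixes X :: "'a \<Rightarrow> real"
  assumes [measurable]: "X \<in> borel_measurable M" and X: "\<And>x. 0 \<le> X x" "\<And>x. X x \<le> 1" and "0 \<le> r"
  shows "ennreal ((r - sqrt (\<integral>x. (X x)\<^sup>2 \<partial>M))\<^sup>2) \<le> (\<integral>\<^sup>+ x. ennreal ((r - X x)\<^sup>2) \<partial>M)"
proof -
  have int: "integrable M X" "integrable M (\<lambda>x. (X x)\<^sup>2)"
    using X by (auto intro!: integrable_const_bound[where B = 1] simp: power_le_one)
  have eq: "(r - X x)\<^sup>2 = r\<^sup>2 + (X x)\<^sup>2 - 2 * r * X x" for x
    by (simp add: power2_eq_square algebra_simps)
  have "(expectation X)\<^sup>2 \<le> expectation (\<lambda>x. (X x)\<^sup>2)"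
    using variance_eq[OF int] variance_positive[of X] by simp
  then have "expectation X \<le> sqrt (expectation (\<lambda>x. (X x)\<^sup>2))" by (rule real_le_rsqrt)
  then have "r * expectation X \<le> r * sqrt (expectation (\<lambda>x. (X x)\<^sup>2))"
    using \<open>0 \<le> r\<close> by (rule mult_left_mono)
  then have le: "(r - sqrt (expectation (\<lambda>x. (X x)\<^sup>2)))\<^sup>2 \<le> expectation (\<lambda>x. (r - X x)\<^sup>2)"
    using int by (simp add: eq prob_space power2_diff)
  have "integrable M (\<lambda>x. (r - X x)\<^sup>2)"
    using int by (simp add: eq)
  then have "(\<integral>\<^sup>+ x. ennreal ((r - X x)\<^sup>2) \<partial>M) = ennreal (expectation (\<lambda>x. (r - X x)\<^sup>2))"
    by (intro nn_integral_eq_integral) auto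
  with le show ?thesis by (simp add: ennreal_leI)
qed

text \<open>The unnormalised marginal density is \<open>h u = E[exp (- \<Psi> (\<cdot>, u))]\<close>, and its total mass is the
  expected normalising constant by Fubini's theorem. Its root \<open>sqrt (h u)\<close> is the \<open>L\<^sup>2(\<nu>)\<close> norm of
  \<open>exp (- \<Psi> (\<cdot>, u) / 2)\<close>, so the previous lemma applies for each \<open>u\<close>.\<close>
lemma hellinger_marginal_posterior_le:
  assumes "prob_space M" "prob_space \<nu>"
    and [measurable]: "\<Phi> \<in> borel_measurable M" "(\<lambda>(\<omega>, u). \<Psi> \<omega> u) \<in> borel_measurable (\<nu> \<Otimes>\<^sub>M M)"
    and nonneg: "\<And>u. 0 \<le> \<Phi> u" "\<And>\<omega> u. 0 \<le> \<Psi> \<omega> u"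
  shows "(hellinger M (posterior M \<Phi>) (marginal_posterior \<nu> M \<Psi>))\<^sup>2
    \<le> (\<integral>\<^sup>+ u. \<integral>\<^sup>+ \<omega>. ennreal ((exp (- \<Phi> u / 2) - exp (- \<Psi> \<omega> u / 2))\<^sup>2) \<partial>\<nu> \<partial>M) / norm_const M \<Phi>"
proof -
  interpret M: prob_space M by fact
  interpret \<nu>: prob_space \<nu> by fact
  interpret pair_sigma_finite \<nu> M ..
  have sq: "(exp (- (t / 2)))\<^sup>2 = exp (- t)" for t :: real
    by (simp add: power2_eq_square flip: exp_add)
  obtain z where z: "norm_const M \<Phi> = ennreal z" "0 < z"
    using assms by (elim M.norm_const_pos_finite)
  have \<Psi>_meas: "(\<lambda>\<omega>. \<Psi> \<omega> u) \<in> borel_measurable \<nu>" if "u \<in> space M" for u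
    using that by measurable
  define h where "h u = (\<integral>\<omega>. exp (- \<Psi> \<omega> u) \<partial>\<nu>)" for u
  have [measurable]: "h \<in> borel_measurable M" unfolding h_def by measurable
  have h_nonneg: "0 \<le> h u" for u unfolding h_def by simp
  have h: "(\<integral>\<^sup>+ \<omega>. ennreal (exp (- \<Psi> \<omega> u)) \<partial>\<nu>) = ennreal (h u)" if u: "u \<in> space M" for u
    unfolding h_def using nonneg \<Psi>_meas[OF u]
    by (intro nn_integral_eq_integral \<nu>.integrable_const_bound[where B = 1]) auto
  have h_pos: "0 < h u" if u: "u \<in> space M" for u
  proof -
    obtain t where "norm_const \<nu> (\<lambda>\<omega>. \<Psi> \<omega> u) = ennreal t" "0 < t"
      using \<nu>.norm_const_pos_finite[OF \<Psi>_meas[OF u]] nonneg by metis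
    then show ?thesis using h[OF u] h_nonneg[of u] by (simp add: norm_const_def)
  qed
  have EZ: "(\<integral>\<^sup>+ \<omega>. norm_const M (\<Psi> \<omega>) \<partial>\<nu>) = (\<integral>\<^sup>+ u. ennreal (h u) \<partial>M)"
    unfolding norm_const_def by (subst Fubini'[symmetric]) (auto intro!: nn_integral_cong h)
  have h_le: "h u \<le> 1" if u: "u \<in> space M" for u
  proof -
    have "ennreal (h u) \<le> (\<integral>\<^sup>+ \<omega>. 1 \<partial>\<nu>)"
      unfolding h[OF u, symmetric] using nonneg by (intro nn_integral_mono) auto
    then show ?thesis by (simp add: \<nu>.emeasure_space_1)
  qed
  obtain w where w: "(\<integral>\<^sup>+ u. ennreal (h u) \<partial>M) = ennreal w" "0 < w"
  proof -
    have "(\<integral>\<^sup>+ u. ennreal (h u) \<partial>M) \<le> (\<integral>\<^sup>+ u. 1 \<partial>M)"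
      using h_le by (intro nn_integral_mono) auto
    then have "(\<integral>\<^sup>+ u. ennreal (h u) \<partial>M) \<noteq> \<infinity>" by (auto simp: M.emeasure_space_1 top_unique)
    moreover have "(\<integral>\<^sup>+ u. ennreal (h u) \<partial>M) \<noteq> 0"
    proof
      assume "(\<integral>\<^sup>+ u. ennreal (h u) \<partial>M) = 0"
      then have "AE u in M. ennreal (h u) = 0" by (subst (asm) nn_integral_0_iff_AE) auto
      then have "AE u in M. False" using AE_space by eventually_elim (use h_pos in fastforce)
      then show False by simp
    qed
    ultimately show ?thesis
      using that by (cases "\<integral>\<^sup>+ u. ennreal (h u) \<partial>M") (auto simp: less_le)
  qed
  have marg: "marginal_posterior \<nu> M \<Psi> = density M (\<lambda>u. ennreal ((sqrt (h u))\<^sup>2) / ennreal w)"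
    unfolding marginal_posterior_def EZ w(1) using h_nonneg
    by (intro density_cong) (auto simp: h)
  have "(hellinger M (posterior M \<Phi>) (marginal_posterior \<nu> M \<Psi>))\<^sup>2
      \<le> (\<integral>\<^sup>+ u. ennreal ((exp (- \<Phi> u / 2) - sqrt (h u))\<^sup>2) \<partial>M) / ennreal z"
    unfolding marg
    using M.hellinger_power2_le[of "\<lambda>u. exp (- \<Phi> u / 2)" "\<lambda>u. sqrt (h u)" z w] z w h_nonneg
    by (simp add: sq posterior_def norm_const_def)
  also have "\<dots> \<le> (\<integral>\<^sup>+ u. \<integral>\<^sup>+ \<omega>. ennreal ((exp (- \<Phi> u / 2) - exp (- \<Psi> \<omega> u / 2))\<^sup>2) \<partial>\<nu> \<partial>M) / norm_const M \<Phi>"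
    unfolding z(1)
  proof (intro divide_right_mono_ennreal nn_integral_mono)
    fix u assume "u \<in> space M"
    then have [measurable]: "(\<lambda>\<omega>. \<Psi> \<omega> u) \<in> borel_measurable \<nu>" by (rule \<Psi>_meas)
    have "(\<lambda>\<omega>. exp (- \<Psi> \<omega> u / 2)) \<in> borel_measurable \<nu>" by measurable
    then show "ennreal ((exp (- \<Phi> u / 2) - sqrt (h u))\<^sup>2)
        \<le> (\<integral>\<^sup>+ \<omega>. ennreal ((exp (- \<Phi> u / 2) - exp (- \<Psi> \<omega> u / 2))\<^sup>2) \<partial>\<nu>)"
      using \<nu>.power2_diff_L2_norm_le[of "\<lambda>\<omega>. exp (- \<Psi> \<omega> u / 2)" "exp (- \<Phi> u / 2)"] nonneg
      by (simp add: sq h_def)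
  qed
  finally show ?thesis .
qed

section \<open>The mean error of the forward model\<close>

lemma borel_measurable_mean_err:
  fixes H :: "'w \<Rightarrow> 'u \<Rightarrow> 'v::{real_normed_vector, second_countable_topology}"
  assumes "prob_space \<nu>"
    and [measurable]: "G \<in> borel_measurable M" "(\<lambda>(\<omega>, u). H \<omega> u) \<in> borel_measurable (\<nu> \<Otimes>\<^sub>M M)"
  shows "mean_err \<nu> G H q \<in> borel_measurable M"
proof -
  interpret prob_space \<nu> by fact
  show ?thesis unfolding mean_err_def by measurable
qed

lemma mean_err_eq_Lp_norm:
  "mean_err \<nu> G H q u = Lp_norm \<nu> q (\<lambda>\<omega>. ennreal ((norm (G u - H \<omega> u))\<^sup>2))"
proof -
  have "x powr (2 * q) = (x\<^sup>2) powr q" if "0 \<le> x" for x :: real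
    using that by (cases "x = 0") (auto simp: powr_powr[symmetric] powr_numeral)
  then show ?thesis by (simp add: mean_err_def Lp_norm_def epowr_ennreal)
qed

lemma mean_err_one: "mean_err \<nu> G H 1 u = (\<integral>\<^sup>+ \<omega>. ennreal ((norm (G u - H \<omega> u))\<^sup>2) \<partial>\<nu>)"
  by (simp add: mean_err_eq_Lp_norm Lp_norm_def)

lemma mean_err_one_le:
  fixes H :: "'w \<Rightarrow> 'u \<Rightarrow> 'v::{real_normed_vector, second_countable_topology}"
  assumes "prob_space \<nu>" and [measurable]: "(\<lambda>\<omega>. H \<omega> u) \<in> borel_measurable \<nu>" and "1 \<le> q"
  shows "mean_err \<nu> G H 1 u \<le> mean_err \<nu> G H q u"
proof -
  interpret prob_space \<nu> by fact
  show ?thesis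
    unfolding mean_err_eq_Lp_norm using \<open>1 \<le> q\<close>
    by (subst Lp_norm_def) (auto intro!: nn_integral_le_Lp_norm)
qed

lemma mean_square_le_Lp_norm_mean_err:
  fixes H :: "'w \<Rightarrow> 'u \<Rightarrow> 'v::{real_normed_vector, second_countable_topology}"
  assumes "prob_space M" and \<nu>: "prob_space \<nu>"
    and [measurable]: "G \<in> borel_measurable M" and H [measurable]: "(\<lambda>(\<omega>, u). H \<omega> u) \<in> borel_measurable (\<nu> \<Otimes>\<^sub>M M)"
    and "1 \<le> s" "1 \<le> q"
  shows "(\<integral>\<^sup>+ u. mean_err \<nu> G H 1 u \<partial>M) \<le> Lp_norm M s (mean_err \<nu> G H q)"
proof -
  interpret prob_space M by fact
  have "(\<integral>\<^sup>+ u. mean_err \<nu> G H 1 u \<partial>M) \<le> Lp_norm M s (mean_err \<nu> G H 1)"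
    using assms by (intro nn_integral_le_Lp_norm borel_measurable_mean_err)
  also have "\<dots> \<le> Lp_norm M s (mean_err \<nu> G H q)"
  proof (rule Lp_norm_mono)
    fix u assume u: "u \<in> space M"
    then have "(\<lambda>\<omega>. H \<omega> u) \<in> borel_measurable \<nu>" by measurable
    then show "mean_err \<nu> G H 1 u \<le> mean_err \<nu> G H q u"
      using \<nu> \<open>1 \<le> q\<close> by (intro mean_err_one_le)
  qed (use \<open>1 \<le> s\<close> in simp)
  finally show ?thesis .
qed

section \<open>Hellinger error in terms of the model error\<close>

text \<open>In this section \<open>V\<close> is any nonnegative potential on the data space for which
  \<open>exp (- V / 2)\<close> is Lipschitz.\<close>

lemma Lipschitz_root_power2_le:
  fixes V :: "'v::real_normed_vector \<Rightarrow> real"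
  assumes lip: "\<And>v w. \<bar>exp (- V v / 2) - exp (- V w / 2)\<bar> \<le> L * norm (v - w)"
  shows "ennreal ((exp (- V v / 2) - exp (- V w / 2))\<^sup>2) \<le> ennreal (L\<^sup>2) * ennreal ((norm (v - w))\<^sup>2)"
  using power_mono[OF lip[of v w], of 2]
  by (simp add: power_mult_distrib ennreal_leI flip: ennreal_mult)

lemma hellinger_marginal_posterior_le_error:
  fixes H :: "'w \<Rightarrow> 'u \<Rightarrow> 'v::{real_normed_vector, second_countable_topology}"
  assumes M: "prob_space M" and \<nu>: "prob_space \<nu>"
    and [measurable]: "G \<in> borel_measurable M" "(\<lambda>(\<omega>, u). H \<omega> u) \<in> borel_measurable (\<nu> \<Otimes>\<^sub>M M)"
      "V \<in> borel_measurable borel"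
    and V: "\<And>v. 0 \<le> V v"
    and lip: "\<And>v w. \<bar>exp (- V v / 2) - exp (- V w / 2)\<bar> \<le> L * norm (v - w)"
  shows "(hellinger M (posterior M (\<lambda>u. V (G u))) (marginal_posterior \<nu> M (\<lambda>\<omega> u. V (H \<omega> u))))\<^sup>2
    \<le> ennreal (L\<^sup>2) * (\<integral>\<^sup>+ u. mean_err \<nu> G H 1 u \<partial>M) / norm_const M (\<lambda>u. V (G u))" (is "?h \<le> _ / ?Z")
proof -
  have "?h \<le> (\<integral>\<^sup>+ u. \<integral>\<^sup>+ \<omega>. ennreal ((exp (- V (G u) / 2) - exp (- V (H \<omega> u) / 2))\<^sup>2) \<partial>\<nu> \<partial>M) / ?Z"
    using M \<nu> V by (intro hellinger_marginal_posterior_le) auto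
  also have "\<dots> \<le> (\<integral>\<^sup>+ u. \<integral>\<^sup>+ \<omega>. ennreal (L\<^sup>2) * ennreal ((norm (G u - H \<omega> u))\<^sup>2) \<partial>\<nu> \<partial>M) / ?Z"
    by (intro divide_right_mono_ennreal nn_integral_mono Lipschitz_root_power2_le lip)
  also have "(\<integral>\<^sup>+ u. \<integral>\<^sup>+ \<omega>. ennreal (L\<^sup>2) * ennreal ((norm (G u - H \<omega> u))\<^sup>2) \<partial>\<nu> \<partial>M)
      = (\<integral>\<^sup>+ u. ennreal (L\<^sup>2) * mean_err \<nu> G H 1 u \<partial>M)"
    by (intro nn_integral_cong) (simp add: mean_err_one nn_integral_cmult)
  also have "\<dots> = ennreal (L\<^sup>2) * (\<integral>\<^sup>+ u. mean_err \<nu> G H 1 u \<partial>M)"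
    using \<nu> by (intro nn_integral_cmult borel_measurable_mean_err) auto
  finally show ?thesis .
qed

lemma mean_hellinger_posterior_le_error:
  fixes H :: "'w \<Rightarrow> 'u \<Rightarrow> 'v::{real_normed_vector, second_countable_topology}"
  assumes "prob_space M" and "prob_space \<nu>"
    and [measurable]: "G \<in> borel_measurable M" "(\<lambda>(\<omega>, u). H \<omega> u) \<in> borel_measurable (\<nu> \<Otimes>\<^sub>M M)"
      "V \<in> borel_measurable borel"
    and V: "\<And>v. 0 \<le> V v"
    and lip: "\<And>v w. \<bar>exp (- V v / 2) - exp (- V w / 2)\<bar> \<le> L * norm (v - w)"
  shows "(\<integral>\<^sup>+ \<omega>. (hellinger M (posterior M (\<lambda>u. V (G u))) (posterior M (\<lambda>u. V (H \<omega> u))))\<^sup>2 \<partial>\<nu>)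
    \<le> ennreal (L\<^sup>2) * (\<integral>\<^sup>+ u. mean_err \<nu> G H 1 u \<partial>M) / norm_const M (\<lambda>u. V (G u))" (is "?h \<le> _ / ?Z")
proof -
  interpret M: prob_space M by fact
  interpret \<nu>: prob_space \<nu> by fact
  interpret pair_sigma_finite \<nu> M ..
  have "?h \<le> (\<integral>\<^sup>+ \<omega>. (\<integral>\<^sup>+ u. ennreal (L\<^sup>2) * ennreal ((norm (G u - H \<omega> u))\<^sup>2) \<partial>M) / ?Z \<partial>\<nu>)"
  proof (rule nn_integral_mono)
    fix \<omega> assume \<omega>: "\<omega> \<in> space \<nu>"
    then have [measurable]: "H \<omega> \<in> borel_measurable M" by measurable
    have "(hellinger M (posterior M (\<lambda>u. V (G u))) (posterior M (\<lambda>u. V (H \<omega> u))))\<^sup>2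
        \<le> (\<integral>\<^sup>+ u. ennreal ((exp (- V (G u) / 2) - exp (- V (H \<omega> u) / 2))\<^sup>2) \<partial>M) / ?Z"
      using V by (intro M.hellinger_posterior_le) auto
    also have "\<dots> \<le> (\<integral>\<^sup>+ u. ennreal (L\<^sup>2) * ennreal ((norm (G u - H \<omega> u))\<^sup>2) \<partial>M) / ?Z"
      by (intro divide_right_mono_ennreal nn_integral_mono Lipschitz_root_power2_le lip)
    finally show "(hellinger M (posterior M (\<lambda>u. V (G u))) (posterior M (\<lambda>u. V (H \<omega> u))))\<^sup>2
        \<le> (\<integral>\<^sup>+ u. ennreal (L\<^sup>2) * ennreal ((norm (G u - H \<omega> u))\<^sup>2) \<partial>M) / ?Z" .
  qed
  also have "\<dots> = (\<integral>\<^sup>+ \<omega>. \<integral>\<^sup>+ u. ennreal (L\<^sup>2) * ennreal ((norm (G u - H \<omega> u))\<^sup>2) \<partial>M \<partial>\<nu>) / ?Z"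
    by (intro nn_integral_divide) measurable
  also have "(\<integral>\<^sup>+ \<omega>. \<integral>\<^sup>+ u. ennreal (L\<^sup>2) * ennreal ((norm (G u - H \<omega> u))\<^sup>2) \<partial>M \<partial>\<nu>)
      = (\<integral>\<^sup>+ u. \<integral>\<^sup>+ \<omega>. ennreal (L\<^sup>2) * ennreal ((norm (G u - H \<omega> u))\<^sup>2) \<partial>\<nu> \<partial>M)"
    by (rule Fubini'[symmetric]) measurable
  also have "\<dots> = (\<integral>\<^sup>+ u. ennreal (L\<^sup>2) * mean_err \<nu> G H 1 u \<partial>M)"
    by (intro nn_integral_cong) (simp add: mean_err_one nn_integral_cmult)
  also have "\<dots> = ennreal (L\<^sup>2) * (\<integral>\<^sup>+ u. mean_err \<nu> G H 1 u \<partial>M)"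
    by (intro nn_integral_cmult borel_measurable_mean_err) (auto intro: \<nu>.prob_space_axioms)
  finally show ?thesis .
qed

section \<open>Rates and convergence\<close>

theorem theorem3p9:
  fixes \<mu>0 :: "'u::{banach, second_countable_topology} measure"
    and Om :: "'w measure"
    and \<nu> :: "nat \<Rightarrow> 'w measure"
    and \<Gamma> :: "real^'j^'j"
    and y :: "real^'j"
    and G :: "'u \<Rightarrow> real^'j"
    and GN :: "nat \<Rightarrow> 'w \<Rightarrow> 'u \<Rightarrow> real^'j"
    and \<Phi> :: "'u \<Rightarrow> real"
    and \<Phi>N :: "nat \<Rightarrow> 'w \<Rightarrow> 'u \<Rightarrow> real"
  assumes prior: "prob_space \<mu>0" "sets \<mu>0 = sets borel"
    and nu: "\<And>N. prob_space (\<nu> N)" "\<And>N. sets (\<nu> N) = sets Om"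
    and Gamma: "sym_pos_def \<Gamma>"
    and G_meas: "G \<in> borel \<rightarrow>\<^sub>M borel"
    and GN_meas: "\<And>N. (\<lambda>(\<omega>, u). GN N \<omega> u) \<in> Om \<Otimes>\<^sub>M borel \<rightarrow>\<^sub>M borel"
    and Phi: "\<And>u. \<Phi> u = misfit \<Gamma> y (G u)"
    and PhiN: "\<And>N \<omega> u. \<Phi>N N \<omega> u = misfit \<Gamma> y (GN N \<omega> u)"
    and Z: "0 < norm_const \<mu>0 \<Phi>" "norm_const \<mu>0 \<Phi> < \<infinity>"
  shows "(\<forall>p::real. p > 1 \<longrightarrow>
       in_Lp \<mu>0 p (\<lambda>u. ennreal (exp (\<Phi> u))) \<longrightarrow>
       (\<exists>C4::real. C4 > 0 \<and> (\<forall>N. emeasure (\<nu> N)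
          {\<omega> \<in> space (\<nu> N). (\<integral>\<^sup>+ u. ennreal (\<Phi>N N \<omega> u) \<partial>\<mu>0) \<le> ennreal C4} = 1)) \<longrightarrow>
       (\<lambda>N. Lp_norm \<mu>0 (2*p/(p-1)) (mean_err (\<nu> N) G (GN N) 2)) \<longlonglongrightarrow> 0 \<longrightarrow>
       (\<exists>C::real. C > 0 \<and> (\<forall>N. hellinger \<mu>0 (posterior \<mu>0 \<Phi>) (marginal_posterior (\<nu> N) \<mu>0 (\<Phi>N N))
             \<le> ennreal C * epowr (Lp_norm \<mu>0 (2*p/(p-1)) (mean_err (\<nu> N) G (GN N) 1)) (1/2))) \<and>
       (\<exists>D::real. D > 0 \<and> (\<forall>N. epowr (\<integral>\<^sup>+ \<omega>. (hellinger \<mu>0 (posterior \<mu>0 \<Phi>) (posterior \<mu>0 (\<Phi>N N \<omega>)))\<^sup>2 \<partial>\<nu> N) (1/2)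
             \<le> ennreal D * epowr (Lp_norm \<mu>0 2 (mean_err (\<nu> N) G (GN N) 2)) (1/2))) \<and>
       (\<lambda>N. hellinger \<mu>0 (posterior \<mu>0 \<Phi>) (marginal_posterior (\<nu> N) \<mu>0 (\<Phi>N N))) \<longlonglongrightarrow> 0 \<and>
       (\<lambda>N. epowr (\<integral>\<^sup>+ \<omega>. (hellinger \<mu>0 (posterior \<mu>0 \<Phi>) (posterior \<mu>0 (\<Phi>N N \<omega>)))\<^sup>2 \<partial>\<nu> N) (1/2)) \<longlonglongrightarrow> 0) \<and>
     (\<forall>\<rho>::real. \<rho> > 2 \<longrightarrow>
       (\<forall>N. in_Lp \<mu>0 1 (\<lambda>u. \<integral>\<^sup>+ \<omega>. ennreal (exp (\<rho> * \<Phi>N N \<omega> u)) \<partial>\<nu> N)) \<longrightarrow>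
       (\<lambda>N. Lp_norm \<mu>0 (2*\<rho>/(\<rho>-1)) (mean_err (\<nu> N) G (GN N) (2*\<rho>/(\<rho>-2)))) \<longlonglongrightarrow> 0 \<longrightarrow>
       (\<exists>C::real. C > 0 \<and> (\<forall>N. hellinger \<mu>0 (posterior \<mu>0 \<Phi>) (marginal_posterior (\<nu> N) \<mu>0 (\<Phi>N N))
             \<le> ennreal C * epowr (Lp_norm \<mu>0 (2*\<rho>/(\<rho>-1)) (mean_err (\<nu> N) G (GN N) 1)) (1/2))) \<and>
       (\<exists>D::real. D > 0 \<and> (\<forall>N. epowr (\<integral>\<^sup>+ \<omega>. (hellinger \<mu>0 (posterior \<mu>0 \<Phi>) (posterior \<mu>0 (\<Phi>N N \<omega>)))\<^sup>2 \<partial>\<nu> N) (1/2)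
             \<le> ennreal D * epowr (Lp_norm \<mu>0 2 (mean_err (\<nu> N) G (GN N) (2*\<rho>/(\<rho>-2)))) (1/2))) \<and>
       (\<lambda>N. hellinger \<mu>0 (posterior \<mu>0 \<Phi>) (marginal_posterior (\<nu> N) \<mu>0 (\<Phi>N N))) \<longlonglongrightarrow> 0 \<and>
       (\<lambda>N. epowr (\<integral>\<^sup>+ \<omega>. (hellinger \<mu>0 (posterior \<mu>0 \<Phi>) (posterior \<mu>0 (\<Phi>N N \<omega>)))\<^sup>2 \<partial>\<nu> N) (1/2)) \<longlonglongrightarrow> 0)"
proof -
  have [measurable]: "G \<in> borel_measurable \<mu>0"
    using G_meas measurable_cong_sets[OF prior(2) refl] by blast
  have GN_meas' [measurable]: "(\<lambda>(\<omega>, u). GN N \<omega> u) \<in> borel_measurable (\<nu> N \<Otimes>\<^sub>M \<mu>0)" for N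
    using GN_meas[of N] measurable_cong_sets[OF sets_pair_measure_cong[OF nu(2) prior(2)] refl] by blast
  have Phi': "\<Phi> = (\<lambda>u. misfit \<Gamma> y (G u))"
    using Phi by (intro ext)
  have PhiN': "\<Phi>N = (\<lambda>N \<omega> u. misfit \<Gamma> y (GN N \<omega> u))"
    using PhiN by (intro ext)
  define m where "m N = (\<integral>\<^sup>+ u. mean_err (\<nu> N) G (GN N) 1 u \<partial>\<mu>0)" for N
  define marg where "marg N = hellinger \<mu>0 (posterior \<mu>0 \<Phi>) (marginal_posterior (\<nu> N) \<mu>0 (\<Phi>N N))" for N
  define samp where "samp N =
    epowr (\<integral>\<^sup>+ \<omega>. (hellinger \<mu>0 (posterior \<mu>0 \<Phi>) (posterior \<mu>0 (\<Phi>N N \<omega>)))\<^sup>2 \<partial>\<nu> N) (1/2)" for N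
  define E where "E s q N = Lp_norm \<mu>0 s (mean_err (\<nu> N) G (GN N) q)" for s q N
  obtain L where L: "0 < L"
      "\<And>v w. \<bar>exp (- misfit \<Gamma> y v / 2) - exp (- misfit \<Gamma> y w / 2)\<bar> \<le> L * norm (v - w)"
    using root_likelihood_lipschitz[of \<Gamma> y] by blast
  obtain z where z: "norm_const \<mu>0 \<Phi> = ennreal z" "0 < z"
    using Z by (cases "norm_const \<mu>0 \<Phi>") auto
  define k where "k = L\<^sup>2 / z"
  have k: "0 < k" using L z by (simp add: k_def)
  have scale: "ennreal (L\<^sup>2) * X / norm_const \<mu>0 \<Phi> = ennreal k * X" for X
    using z L unfolding k_def
    by (simp add: ennreal_times_divide mult.commute flip: divide_ennreal)
  define K where "K = k powr (1/2)"
  have K: "0 < K" using k by (simp add: K_def)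
  have marg_le: "marg N \<le> ennreal K * epowr (m N) (1/2)" for N
  proof -
    have "(marg N)\<^sup>2 \<le> ennreal (L\<^sup>2) * m N / norm_const \<mu>0 \<Phi>"
      unfolding marg_def m_def Phi' PhiN' using prior(1) nu(1) L(2)
      by (intro hellinger_marginal_posterior_le_error) (auto simp: misfit_nonneg)
    then have "epowr ((marg N)\<^sup>2) (1/2) \<le> epowr (ennreal k * m N) (1/2)"
      unfolding scale by (intro epowr_mono) auto
    then show ?thesis using k by (simp only: epowr_power2_half epowr_cmult K_def)
  qed
  have samp_le: "samp N \<le> ennreal K * epowr (m N) (1/2)" for N
  proof -
    have "(\<integral>\<^sup>+ \<omega>. (hellinger \<mu>0 (posterior \<mu>0 \<Phi>) (posterior \<mu>0 (\<Phi>N N \<omega>)))\<^sup>2 \<partial>\<nu> N)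
        \<le> ennreal (L\<^sup>2) * m N / norm_const \<mu>0 \<Phi>"
      unfolding m_def Phi' PhiN' using prior(1) nu(1) L(2)
      by (intro mean_hellinger_posterior_le_error) (auto simp: misfit_nonneg)
    then have "samp N \<le> epowr (ennreal k * m N) (1/2)"
      unfolding scale samp_def by (intro epowr_mono) auto
    then show ?thesis using k by (simp only: epowr_cmult K_def)
  qed
  have m_le: "m N \<le> E s q N" if "1 \<le> s" "1 \<le> q" for s q N
    unfolding m_def E_def using that prior(1) nu(1) by (intro mean_square_le_Lp_norm_mean_err) auto
  have bound: "X \<le> ennreal K * epowr (E s q N) (1/2)"
    if "X \<le> ennreal K * epowr (m N) (1/2)" "1 \<le> s" "1 \<le> q" for X s q N
    using that(1) mult_left_mono[OF epowr_mono[OF m_le[OF that(2,3)], of "1/2"], of "ennreal K" N]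
    by (auto intro: order_trans)
  have lim: "X \<longlonglongrightarrow> 0"
    if X: "\<And>N. X N \<le> ennreal K * epowr (m N) (1/2)" and E: "E s q \<longlonglongrightarrow> 0" and sq: "1 \<le> s" "1 \<le> q"
    for X :: "nat \<Rightarrow> ennreal" and s q
  proof (rule tendsto_sandwich[where f = "\<lambda>_. 0"])
    show "\<forall>\<^sub>F N in sequentially. X N \<le> ennreal K * epowr (E s q N) (1/2)"
      using bound[OF X sq] by simp
    show "(\<lambda>N. ennreal K * epowr (E s q N) (1/2)) \<longlonglongrightarrow> 0"
      using ennreal_tendsto_cmult[OF _ tendsto_epowr_zero[OF E, of "1/2"], of "ennreal K"] by simp
  qed auto
  \<comment> \<open>common to both parts, which differ only in the exponents \<open>s\<close> and \<open>q\<close>\<close>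
  have conclusion: "(\<exists>C::real. C > 0 \<and> (\<forall>N. marg N \<le> ennreal C * epowr (E s 1 N) (1/2))) \<and>
      (\<exists>D::real. D > 0 \<and> (\<forall>N. samp N \<le> ennreal D * epowr (E 2 q N) (1/2))) \<and>
      marg \<longlonglongrightarrow> 0 \<and> samp \<longlonglongrightarrow> 0"
    if "E s q \<longlonglongrightarrow> 0" "1 \<le> s" "1 \<le> q" for s q
    using K that by (auto intro!: exI[of _ K] bound marg_le samp_le lim[of _ s q])
  show ?thesis
    unfolding marg_def[symmetric] samp_def[symmetric] E_def[symmetric]
    by (intro conjI[of "\<forall>p. _ p"] allI impI conclusion) (auto simp: field_simps)
qed

end
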